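(* Let $(X, \Vert\cdot\Vert)$ be a real normed linear space and let $e \in X$ with $\Vert e \Vert = 1$ be a norming order unit for $X$. Put $$X_e^+ = \{ x \in X : \Vert 2 x - \Vert x \Vert e \Vert \le \Vert x \Vert \}.$$ Then $X_e^+$ is a proper and Archimedean cone in $X$ and $e$ is an order unit for $(X, X_e^+)$, so that $(X, X_e^+, e)$ is an order unit space. Moreover, $e$ determines $\Vert\cdot\Vert$ as an order unit norm on $X$, i.e. $\Vert x \Vert = \inf\{ \lambda > 0 : \lambda e \pm x \in X_e^+ \}$ for all $x \in X$.
   Context: Let $X$ be a non-zero real normed linear space and $e \in X$ with $\Vert e \Vert = 1$. We say $e$ is a norming order unit for $X$ if for every $x \in X$: $\Vert 2x - \Vert x \Vert e \Vert \le \Vert x \Vert$ whenever $\Vert 2x - \lambda e \Vert \le \lambda$ for some $\lambda \ge \Vert x \Vert$. A cone $V^+$ in a real vector space $V$ is a nonempty subset closed under addition and under multiplication by non-negative reals. An element $e \in V^+$ is an order unit for $(V, V^+)$ if for every $v \in V$ there is a real $\lambda > 0$ with $\lambda e \pm v \in V^+$ (both signs). $V^+$ is proper if $V^+ \cap -V^+ = \{0\}$. $V^+$ is Archimedean if for every $v \in V$ such that $\lambda u + v \in V^+$ for some fixed $u \in V$ and all $\lambda > 0$, one has $v \in V^+$. An order unit space $(V, V^+, e)$ is a real vector space with a proper Archimedean cone $V^+$ and an order unit $e$; its order unit norm is $\Vert v \Vert_e := \inf\{ \lambda > 0 : \lambda e \pm v \in V^+ \}$. *)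

theory Defs
  imports "HOL-Analysis.Analysis"
begin

text \<open>
  A cone here is nonempty and closed under addition, unlike the library's predicate
  \<^const>\<open>cone\<close>, which only requires closure under scaling by non-negative reals.
\<close>

definition order_cone :: "'a::real_vector set \<Rightarrow> bool" where
  "order_cone C \<longleftrightarrow> C \<noteq> {} \<and> (\<forall>x\<in>C. \<forall>y\<in>C. x + y \<in> C) \<and> conic C"

definition proper_cone :: "'a::real_vector set \<Rightarrow> bool" where
  "proper_cone C \<longleftrightarrow> order_cone C \<and> C \<inter> uminus ` C = {0}"

text \<open>The vector \<open>u\<close> may depend on \<open>v\<close> but not on the scalar \<open>c\<close>.\<close>

definition archimedean_cone :: "'a::real_vector set \<Rightarrow> bool" where
  "archimedean_cone C \<longleftrightarrow> order_cone C \<and>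
     (\<forall>v. (\<exists>u. \<forall>c>0. c *\<^sub>R u + v \<in> C) \<longrightarrow> v \<in> C)"

definition order_unit :: "'a::real_vector set \<Rightarrow> 'a \<Rightarrow> bool" where
  "order_unit C e \<longleftrightarrow> e \<in> C \<and>
     (\<forall>v. \<exists>c>0. c *\<^sub>R e + v \<in> C \<and> c *\<^sub>R e - v \<in> C)"

definition order_unit_space :: "'a::real_vector set \<Rightarrow> 'a \<Rightarrow> bool" where
  "order_unit_space C e \<longleftrightarrow> proper_cone C \<and> archimedean_cone C \<and> order_unit C e"

definition order_unit_norm :: "'a::real_vector set \<Rightarrow> 'a \<Rightarrow> 'a \<Rightarrow> real" where
  "order_unit_norm C e v = Inf {c. c > 0 \<and> c *\<^sub>R e + v \<in> C \<and> c *\<^sub>R e - v \<in> C}"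

definition norming_order_unit :: "'a::real_normed_vector \<Rightarrow> bool" where
  "norming_order_unit e \<longleftrightarrow> norm e = 1 \<and>
     (\<forall>x. (\<exists>c\<ge>norm x. norm (2 *\<^sub>R x - c *\<^sub>R e) \<le> c)
          \<longrightarrow> norm (2 *\<^sub>R x - norm x *\<^sub>R e) \<le> norm x)"

definition norming_cone :: "'a::real_normed_vector \<Rightarrow> 'a set" where
  "norming_cone e = {x. norm (2 *\<^sub>R x - norm x *\<^sub>R e) \<le> norm x}"

end

theory Submission
  imports Defs
begin

text \<open>
  For \<open>c > 0\<close>, dividing \<open>norm (2 *\<^sub>R x - c *\<^sub>R e) \<le> c\<close> by \<open>2 * c\<close> shows that it says that
  \<open>x / c\<close> lies in the closed ball of radius \<open>1/2\<close> around \<open>e / 2\<close>. The vectors that satisfy it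
  for some \<open>c\<close> therefore form the cone generated by that ball, and such a \<open>c\<close> is automatically
  at least \<open>norm x\<close>. Being a norming order unit says exactly that \<open>c\<close> can be lowered to
  \<open>norm x\<close>, so \<^term>\<open>norming_cone e\<close> is this generated cone (\<open>norming_coneI\<close>); conversely,
  \<open>c\<close> can always be raised (\<open>norming_cone_bound\<close>). Freedom in \<open>c\<close> gives closure under addition and places
  \<open>c *\<^sub>R e + x\<close> in the cone as soon as \<open>norm x \<le> c\<close>. The Archimedean property holds
  because the cone is topologically closed.

  It remains to see that \<open>c *\<^sub>R e + x\<close> and \<open>c *\<^sub>R e - x\<close> lie in the cone only if \<open>norm x \<le> c\<close>.
  Both vectors have norm at most \<open>c + norm x\<close>; testing both with this common bound
  and taking the difference cancels \<open>e\<close> and leaves \<open>4 * norm x \<le> 2 * (c + norm x)\<close>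
  (\<open>norm_le_if_in_norming_cone\<close>).
\<close>

lemma norming_coneI:
  assumes "norming_order_unit e" and le: "norm (2 *\<^sub>R x - c *\<^sub>R e) \<le> c"
  shows "x \<in> norming_cone e"
proof -
  have e: "norm e = 1"
    using assms(1) by (simp add: norming_order_unit_def)
  have "0 \<le> c"
    using le norm_ge_zero order_trans by blast
  have "norm (2 *\<^sub>R x) \<le> norm (2 *\<^sub>R x - c *\<^sub>R e) + norm (c *\<^sub>R e)"
    by (metis diff_add_cancel norm_triangle_ineq)
  then have "norm x \<le> c"
    using le e \<open>0 \<le> c\<close> by simp
  then show ?thesis
    using assms by (auto simp: norming_order_unit_def norming_cone_def)
qed

text \<open>Raising the parameter by \<open>d\<close> moves the centre by \<open>d *\<^sub>R e\<close>, of norm \<open>d\<close>, and the radius by \<open>d\<close>.\<close>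

lemma norming_cone_bound:
  assumes "norm e = 1" "x \<in> norming_cone e" "norm x \<le> c"
  shows "norm (2 *\<^sub>R x - c *\<^sub>R e) \<le> c"
proof -
  have "2 *\<^sub>R x - c *\<^sub>R e = (2 *\<^sub>R x - norm x *\<^sub>R e) - (c - norm x) *\<^sub>R e"
    by (simp add: algebra_simps)
  then have "norm (2 *\<^sub>R x - c *\<^sub>R e)
      \<le> norm (2 *\<^sub>R x - norm x *\<^sub>R e) + norm ((c - norm x) *\<^sub>R e)"
    by (metis norm_triangle_ineq4)
  also have "\<dots> \<le> norm x + (c - norm x)"
    using assms by (simp add: norming_cone_def)
  finally show ?thesis
    by simp
qed

lemma norming_cone_add:
  assumes "norming_order_unit e" "x \<in> norming_cone e" "y \<in> norming_cone e"
  shows "x + y \<in> norming_cone e"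
proof (rule norming_coneI[OF assms(1)])
  have "2 *\<^sub>R (x + y) - (norm x + norm y) *\<^sub>R e
      = (2 *\<^sub>R x - norm x *\<^sub>R e) + (2 *\<^sub>R y - norm y *\<^sub>R e)"
    by (simp add: algebra_simps)
  then have "norm (2 *\<^sub>R (x + y) - (norm x + norm y) *\<^sub>R e)
      \<le> norm (2 *\<^sub>R x - norm x *\<^sub>R e) + norm (2 *\<^sub>R y - norm y *\<^sub>R e)"
    by (metis norm_triangle_ineq)
  also have "\<dots> \<le> norm x + norm y"
    using assms(2,3) by (intro add_mono) (auto simp: norming_cone_def)
  finally show "norm (2 *\<^sub>R (x + y) - (norm x + norm y) *\<^sub>R e) \<le> norm x + norm y" .
qed

lemma norming_cone_scaleR:
  assumes "x \<in> norming_cone e" "0 \<le> c"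
  shows "c *\<^sub>R x \<in> norming_cone e"
proof -
  have "2 *\<^sub>R (c *\<^sub>R x) - norm (c *\<^sub>R x) *\<^sub>R e = c *\<^sub>R (2 *\<^sub>R x - norm x *\<^sub>R e)"
    using assms(2) by (simp add: algebra_simps)
  then show ?thesis
    using assms by (simp add: norming_cone_def mult_left_mono)
qed

lemma order_cone_norming_cone:
  assumes "norming_order_unit e"
  shows "order_cone (norming_cone e)"
proof -
  have "0 \<in> norming_cone e"
    by (simp add: norming_cone_def)
  then show ?thesis
    using norming_cone_add[OF assms] norming_cone_scaleR
    unfolding order_cone_def conic_def by blast
qed

text \<open>
  This estimate is the source both of properness, where \<open>c = 0\<close>, and of the
  lower bound for the order unit norm.
\<close>

lemma norm_le_if_in_norming_cone:
  assumes e: "norm e = 1" and "0 \<le> c"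
    and plus: "c *\<^sub>R e + x \<in> norming_cone e" and minus: "c *\<^sub>R e - x \<in> norming_cone e"
  shows "norm x \<le> c"
proof -
  let ?d = "c + norm x"
  have "norm (c *\<^sub>R e + x) \<le> ?d" "norm (c *\<^sub>R e - x) \<le> ?d"
    using norm_triangle_ineq[of "c *\<^sub>R e" x] norm_triangle_ineq4[of "c *\<^sub>R e" x] e \<open>0 \<le> c\<close>
    by simp_all
  then have bounds: "norm (2 *\<^sub>R (c *\<^sub>R e + x) - ?d *\<^sub>R e) \<le> ?d"
      "norm (2 *\<^sub>R (c *\<^sub>R e - x) - ?d *\<^sub>R e) \<le> ?d"
    using norming_cone_bound[OF e plus] norming_cone_bound[OF e minus] by blast+
  have "4 *\<^sub>R x = (2 *\<^sub>R (c *\<^sub>R e + x) - ?d *\<^sub>R e) - (2 *\<^sub>R (c *\<^sub>R e - x) - ?d *\<^sub>R e)"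
    by (simp add: algebra_simps flip: scaleR_add_left)
  then have "norm (4 *\<^sub>R x)
      \<le> norm (2 *\<^sub>R (c *\<^sub>R e + x) - ?d *\<^sub>R e) + norm (2 *\<^sub>R (c *\<^sub>R e - x) - ?d *\<^sub>R e)"
    by (metis norm_triangle_ineq4)
  then show ?thesis
    using bounds by simp
qed

lemma in_norming_cone_if_norm_le:
  assumes "norming_order_unit e" "norm x \<le> c"
  shows "c *\<^sub>R e + x \<in> norming_cone e" and "c *\<^sub>R e - x \<in> norming_cone e"
proof -
  \<comment> \<open>The parameter \<open>2 * c\<close> cancels the multiple of \<open>e\<close>.\<close>
  have "2 *\<^sub>R (c *\<^sub>R e + x) - (2 * c) *\<^sub>R e = 2 *\<^sub>R x"
       "2 *\<^sub>R (c *\<^sub>R e - x) - (2 * c) *\<^sub>R e = - (2 *\<^sub>R x)"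
    by (simp_all add: algebra_simps)
  then show "c *\<^sub>R e + x \<in> norming_cone e" "c *\<^sub>R e - x \<in> norming_cone e"
    using assms by (auto intro!: norming_coneI[where c = "2 * c"])
qed

lemma proper_cone_norming_cone:
  assumes "norming_order_unit e"
  shows "proper_cone (norming_cone e)"
proof -
  have e: "norm e = 1"
    using assms by (simp add: norming_order_unit_def)
  have "x = 0" if "x \<in> norming_cone e" "- x \<in> norming_cone e" for x
    using norm_le_if_in_norming_cone[OF e, of 0 x] that by simp
  moreover have "0 \<in> norming_cone e"
    by (simp add: norming_cone_def)
  ultimately have "norming_cone e \<inter> uminus ` norming_cone e = {0}"
    by (force simp: image_iff)
  then show ?thesis
    using order_cone_norming_cone[OF assms] by (simp add: proper_cone_def)
qed

lemma closed_norming_cone: "closed (norming_cone e)"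
  unfolding norming_cone_def by (intro closed_Collect_le continuous_intros)

lemma archimedean_cone_if_closed:
  fixes C :: "'a::real_normed_vector set"
  assumes "order_cone C" "closed C"
  shows "archimedean_cone C"
proof -
  have "v \<in> C" if "\<forall>c>0. c *\<^sub>R u + v \<in> C" for u v
  proof (rule closed_sequentially[OF assms(2)])
    show "inverse (real (Suc n)) *\<^sub>R u + v \<in> C" for n
      using that by simp
    have "(\<lambda>n. inverse (real (Suc n)) *\<^sub>R u + v) \<longlonglongrightarrow> 0 *\<^sub>R u + v"
      by (intro tendsto_intros LIMSEQ_inverse_real_of_nat)
    then show "(\<lambda>n. inverse (real (Suc n)) *\<^sub>R u + v) \<longlonglongrightarrow> v"
      by simp
  qed
  then show ?thesis
    using assms(1) unfolding archimedean_cone_def by blast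
qed

lemma order_unit_norming_cone:
  assumes "norming_order_unit e"
  shows "order_unit (norming_cone e) e"
proof -
  have "e \<in> norming_cone e"
    using in_norming_cone_if_norm_le(1)[OF assms, of 0 1] by simp
  moreover have "\<exists>c>0. c *\<^sub>R e + v \<in> norming_cone e \<and> c *\<^sub>R e - v \<in> norming_cone e" for v
    using in_norming_cone_if_norm_le[OF assms, of v "norm v + 1"]
    by (intro exI[of _ "norm v + 1"]) (auto intro: add_nonneg_pos)
  ultimately show ?thesis
    by (simp add: order_unit_def)
qed

lemma order_unit_norm_norming_cone:
  assumes "norming_order_unit e"
  shows "order_unit_norm (norming_cone e) e x = norm x"
proof -
  have e: "norm e = 1"
    using assms by (simp add: norming_order_unit_def)
  have iff: "c *\<^sub>R e + x \<in> norming_cone e \<and> c *\<^sub>R e - x \<in> norming_cone e \<longleftrightarrow> norm x \<le> c"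
    if "0 < c" for c
    using that norm_le_if_in_norming_cone[OF e, of c x]
      in_norming_cone_if_norm_le[OF assms, of x c] by auto
  show ?thesis
  proof (cases "x = 0")
    \<comment> \<open>For \<open>x = 0\<close> the infimum is not attained, as only positive scalars are admitted.\<close>
    case True
    then have "{c. 0 < c \<and> c *\<^sub>R e + x \<in> norming_cone e \<and> c *\<^sub>R e - x \<in> norming_cone e} = {0<..}"
      using iff by auto
    then show ?thesis
      using True by (simp add: order_unit_norm_def)
  next
    case False
    then have "{c. 0 < c \<and> c *\<^sub>R e + x \<in> norming_cone e \<and> c *\<^sub>R e - x \<in> norming_cone e}
        = {norm x..}"
      using iff in_norming_cone_if_norm_le[OF assms, of x]
      by (auto intro: less_le_trans[of 0 "norm x"])
    then show ?thesis
      by (simp add: order_unit_norm_def)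
  qed
qed

theorem theorem3p3:
  fixes e :: "'a::real_normed_vector"
  assumes "norm e = 1"
    and "norming_order_unit e"
  shows "proper_cone (norming_cone e)
    \<and> archimedean_cone (norming_cone e)
    \<and> order_unit (norming_cone e) e
    \<and> order_unit_space (norming_cone e) e
    \<and> (\<forall>x. norm x = order_unit_norm (norming_cone e) e x)"
  using proper_cone_norming_cone[OF assms(2)]
    archimedean_cone_if_closed[OF order_cone_norming_cone[OF assms(2)] closed_norming_cone]
    order_unit_norming_cone[OF assms(2)] order_unit_norm_norming_cone[OF assms(2)]
  by (simp add: order_unit_space_def)

end
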